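(* Let $S$ be a semigroup and let $\sigma$ be an involutive automorphism of $S$. Let $g:S\to\mathbb{C}$ be a solution of $$g(xy)+g(x\sigma(y))=2g(x)g(y),\quad x,y\in S.$$ If there exists a complex measure $\mu$ that is a linear combination of Dirac measures $(\delta_{z_i})_{i\in I}$, with $z_i$ contained in the center of $S$ for all $i\in I$, such that $$\int_S g(t)\,d\mu(t)=0\quad\text{and}\quad\int_S\int_S g(ts)\,d\mu(t)\,d\mu(s)\neq 0,$$ then there exists a non-zero multiplicative function $\chi:S\to\mathbb{C}$ such that $$g=\frac{\chi+\chi\circ\sigma}{2}.$$
   Context: A semigroup is a set with an associative operation, written multiplicatively. An involutive automorphism of $S$ is a map $\sigma:S\to S$ with $\sigma(xy)=\sigma(x)\sigma(y)$ and $\sigma(\sigma(x))=x$ for all $x,y\in S$. The measure is $\mu=\sum_{i\in I}\alpha_i\delta_{z_i}$ (finite linear combination, $\alpha_i\in\mathbb{C}$), so $\int_S h(t)\,d\mu(t)=\sum_i\alpha_i h(z_i)$. A function $\chi:S\to\mathbb{C}$ is multiplicative if $\chi(xy)=\chi(x)\chi(y)$ for all $x,y\in S$. *)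

theory Defs
  imports "HOL-Probability.Giry_Monad"
begin

definition semigroup_center :: "'a::semigroup_mult set" where
  "semigroup_center = {z. \<forall>x. z * x = x * z}"

definition involutive_automorphism :: "('a::semigroup_mult \<Rightarrow> 'a) \<Rightarrow> bool" where
  "involutive_automorphism \<sigma> \<longleftrightarrow>
     (\<forall>x y. \<sigma> (x * y) = \<sigma> x * \<sigma> y) \<and> (\<forall>x. \<sigma> (\<sigma> x) = x)"

definition multiplicative_function :: "('a::semigroup_mult \<Rightarrow> complex) \<Rightarrow> bool" where
  "multiplicative_function chi \<longleftrightarrow> (\<forall>x y. chi (x * y) = chi x * chi y)"

text \<open>
  The semigroup carries no topology, so the Dirac measure at \<open>z\<close> lives on the discrete
  sigma-algebra, on which every complex function is integrable against it.
\<close>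

definition dirac_measure :: "'a \<Rightarrow> 'a measure" where
  "dirac_measure z = return (count_space UNIV) z"

text \<open>
  Integration against the complex measure \<open>\<mu> = (\<Sum>i\<in>I. \<alpha> i \<delta>\<^bsub>z i\<^esub>)\<close>. Measures in the
  library take values in the extended nonnegative reals, so \<open>\<mu>\<close> is represented by
  the data \<open>I\<close>, \<open>\<alpha>\<close>, \<open>z\<close>, and its integral by linearity. The index set
  is meant to be finite.
\<close>

definition dirac_comb_integral ::
  "'i set \<Rightarrow> ('i \<Rightarrow> complex) \<Rightarrow> ('i \<Rightarrow> 'a) \<Rightarrow> ('a \<Rightarrow> complex) \<Rightarrow> complex" where
  "dirac_comb_integral I \<alpha> z h = (\<Sum>i\<in>I. \<alpha> i * (\<integral>t. h t \<partial>dirac_measure (z i)))"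

lemma dirac_comb_integral_eq_sum:
  "dirac_comb_integral I \<alpha> z h = (\<Sum>i\<in>I. \<alpha> i * h (z i))"
  by (simp add: dirac_comb_integral_def dirac_measure_def integral_return)

end

(* Put f(x) = \<integral> g(xt) d\<mu>(t) and c = \<integral> f d\<mu>. Since \<mu> is central and \<integral> g d\<mu> = 0, averaging the functional
   equation over \<mu> shows that f is odd under \<sigma> and that f(xy) + f(x\<sigma>(y)) = 2 f(x) g(y) and
   f(xy) - f(x\<sigma>(y)) = 2 g(x) f(y), hence f(xy) = f(x) g(y) + g(x) f(y). Averaging this law once over y,
   and once more with xt in place of x, gives c g(xy) = c g(x) g(y) + f(x) f(y). So g + f/k is
   multiplicative for any square root k of c. *)

theory Submission
  imports Defs
begin

text \<open>In the expanded product of two values, \<open>g x * g y\<close> and the term quadratic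
  in \<open>f\<close> combine to \<open>g (x * y)\<close> by the cosine law, while the cross terms
  give \<open>f (x * y) / k\<close> by the sine law.\<close>

lemma multiplicative_function_of_sine_cosine_laws:
  fixes f g :: "'a::semigroup_mult \<Rightarrow> complex"
  assumes "k \<noteq> 0"
    and sine: "\<And>x y. f (x * y) = f x * g y + g x * f y"
    and cosine: "\<And>x y. k\<^sup>2 * g (x * y) = k\<^sup>2 * (g x * g y) + f x * f y"
  shows "multiplicative_function (\<lambda>x. g x + f x / k)"
proof -
  have "g (x * y) = g x * g y + f x * f y / k\<^sup>2" for x y
    using cosine[of x y] \<open>k \<noteq> 0\<close> by (simp add: field_simps)
  then show ?thesis
    unfolding multiplicative_function_def using \<open>k \<noteq> 0\<close>
    by (simp add: sine field_simps power2_eq_square)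
qed

text \<open>Replacing \<open>y\<close> by \<open>\<sigma> y\<close> only swaps the two summands on
  the left, so the right side is unchanged and a nonzero factor \<open>g x\<close> can be
  cancelled.\<close>

lemma cosine_equation_invariant:
  fixes \<sigma> :: "'a::semigroup_mult \<Rightarrow> 'a" and g :: "'a \<Rightarrow> complex"
  assumes inv: "involutive_automorphism \<sigma>"
    and g: "\<And>x y. g (x * y) + g (x * \<sigma> y) = 2 * g x * g y"
  shows "g (\<sigma> y) = g y"
proof (cases "\<exists>x. g x \<noteq> 0")
  case True
  then obtain x where "g x \<noteq> 0" by blast
  moreover have "2 * g x * g (\<sigma> y) = 2 * g x * g y"
    using g[of x y] g[of x "\<sigma> y"] inv
    unfolding involutive_automorphism_def by (metis add.commute)
  ultimately show ?thesis by simp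
qed auto

theorem corollary4p4:
  fixes \<sigma> :: "'a::semigroup_mult \<Rightarrow> 'a" and g :: "'a \<Rightarrow> complex"
  assumes "involutive_automorphism \<sigma>"
    and "\<And>x y. g (x * y) + g (x * \<sigma> y) = 2 * g x * g y"
    and "\<exists>(I :: 'i set) (\<alpha> :: 'i \<Rightarrow> complex) (z :: 'i \<Rightarrow> 'a).
           finite I \<and> (\<forall>i\<in>I. z i \<in> semigroup_center) \<and>
           dirac_comb_integral I \<alpha> z g = 0 \<and>
           dirac_comb_integral I \<alpha> z (\<lambda>s. dirac_comb_integral I \<alpha> z (\<lambda>t. g (t * s))) \<noteq> 0"
  shows "\<exists>chi :: 'a \<Rightarrow> complex. multiplicative_function chi \<and> chi \<noteq> (\<lambda>x. 0) \<and>
           g = (\<lambda>x. (chi x + (chi \<circ> \<sigma>) x) / 2)"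
proof -
  obtain I :: "'i set" and \<alpha> :: "'i \<Rightarrow> complex" and z :: "'i \<Rightarrow> 'a" where
    center: "\<forall>i\<in>I. z i \<in> semigroup_center"
    and int_g: "dirac_comb_integral I \<alpha> z g = 0"
    and int2_g: "dirac_comb_integral I \<alpha> z (\<lambda>s. dirac_comb_integral I \<alpha> z (\<lambda>t. g (t * s))) \<noteq> 0"
    using assms(3) by blast
  note \<sigma>_inv = assms(1)[unfolded involutive_automorphism_def]
  define L where "L = dirac_comb_integral I \<alpha> z"
  \<comment> \<open>All mass sits at central points, so an integrand may be rewritten as if its
    variable were central.\<close>
  have L_cong: "L h = L h'" if "\<And>t. t \<in> semigroup_center \<Longrightarrow> h t = h' t" for h h'
    unfolding L_def dirac_comb_integral_eq_sum using center that by (auto intro!: sum.cong)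
  have L_add: "L (\<lambda>t. h t + h' t) = L h + L h'" for h h'
    by (simp add: L_def dirac_comb_integral_eq_sum sum.distrib ring_distribs)
  have L_mult: "L (\<lambda>t. a * h t) = a * L h" for a h
    by (simp add: L_def dirac_comb_integral_eq_sum sum_distrib_left mult.left_commute)
  have L_mult_right: "L (\<lambda>t. h t * a) = L h * a" for a h
    using L_mult[of a h] by (simp add: mult.commute)
  have comm: "t * x = x * t" if "t \<in> semigroup_center" for t x
    using that by (simp add: semigroup_center_def)
  define f where "f x = L (\<lambda>t. g (x * t))" for x
  define c where "c = L f"
  \<comment> \<open>Centrality reconciles the two orders of multiplication, so \<open>c\<close> is
    the double integral assumed nonzero.\<close>
  have "f = (\<lambda>s. L (\<lambda>t. g (t * s)))"
    unfolding f_def by (intro ext L_cong) (simp add: comm)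
  then have c: "c \<noteq> 0" using int2_g by (simp add: c_def L_def)
  have Lg: "L g = 0" using int_g by (simp add: L_def)
  have g_inv: "g (\<sigma> x) = g x" for x
    by (rule cosine_equation_invariant[OF assms(1,2)])
  have L_\<sigma>: "L (\<lambda>t. g (x * \<sigma> t)) = - f x" for x
  proof -
    have "f x + L (\<lambda>t. g (x * \<sigma> t)) = L (\<lambda>t. 2 * g x * g t)"
      unfolding f_def L_add[symmetric] by (simp add: assms(2))
    then show ?thesis by (simp add: L_mult Lg eq_neg_iff_add_eq_0 add.commute)
  qed
  have f_odd: "f (\<sigma> x) = - f x" for x
  proof -
    have "g (\<sigma> x * t) = g (x * \<sigma> t)" for t
      using g_inv[of "x * \<sigma> t"] \<sigma>_inv by simp
    then show ?thesis by (simp add: f_def[of "\<sigma> x"] L_\<sigma>)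
  qed
  \<comment> \<open>Centrality moves \<open>t\<close> next to \<open>x\<close>; then the functional
    equation applies at \<open>x * t\<close> and \<open>y\<close>.\<close>
  have wilson: "f (x * y) + f (x * \<sigma> y) = 2 * f x * g y" for x y
  proof -
    have "f (x * y) + f (x * \<sigma> y) = L (\<lambda>t. g ((x * t) * y) + g ((x * t) * \<sigma> y))"
      unfolding f_def L_add[symmetric]
      by (rule L_cong) (simp add: mult.assoc comm[of _ y] comm[of _ "\<sigma> y"])
    also have "\<dots> = 2 * f x * g y"
      by (simp only: assms(2) L_mult L_mult_right f_def)
    finally show ?thesis .
  qed
  \<comment> \<open>Here the functional equation is taken at \<open>x\<close> and
    \<open>y * t\<close>; the minus sign comes from \<open>L_\<sigma>\<close> at
    \<open>x * \<sigma> y\<close>.\<close>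
  have wilson': "f (x * y) - f (x * \<sigma> y) = 2 * g x * f y" for x y
  proof -
    have "f (x * y) + L (\<lambda>t. g ((x * \<sigma> y) * \<sigma> t)) = L (\<lambda>t. g (x * (y * t)) + g (x * \<sigma> (y * t)))"
      using \<sigma>_inv by (simp add: f_def L_add mult.assoc)
    also have "\<dots> = 2 * g x * f y"
      by (simp add: assms(2) L_mult f_def)
    finally show ?thesis by (simp add: L_\<sigma>)
  qed
  have sine: "f (x * y) = f x * g y + g x * f y" for x y
  proof -
    have "2 * f (x * y) = 2 * (f x * g y + g x * f y)"
      using arg_cong2[OF wilson[of x y] wilson'[of x y], of "(+)"] by (simp add: algebra_simps)
    then show ?thesis by (simp only: mult_cancel_left) simp
  qed
  have Lf: "L (\<lambda>t. f (x * t)) = c * g x" for x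
    by (simp add: sine L_add L_mult L_mult_right Lg c_def)
  \<comment> \<open>The average of \<open>f (x * t * y)\<close> is computed twice: by
    \<open>Lf\<close> at \<open>x * y\<close>, with \<open>t\<close> moved to the end, and by the
    sine law at \<open>x * t\<close> and \<open>y\<close>.\<close>
  have cosine: "c * g (x * y) = c * (g x * g y) + f x * f y" for x y
  proof -
    have "c * g (x * y) = L (\<lambda>t. f ((x * t) * y))"
      unfolding Lf[symmetric] by (rule L_cong) (simp add: mult.assoc comm[of _ y])
    also have "\<dots> = L (\<lambda>t. f (x * t)) * g y + L (\<lambda>t. g (x * t)) * f y"
      by (simp only: sine[of "x * _" y] L_add L_mult_right)
    finally show ?thesis by (simp add: Lf f_def[symmetric] mult.assoc)
  qed
  define k where "k = csqrt c"
  have k: "k \<noteq> 0" "k\<^sup>2 = c" using c by (simp_all add: k_def)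
  define chi where "chi x = g x + f x / k" for x
  have "multiplicative_function chi"
    unfolding chi_def
    by (rule multiplicative_function_of_sine_cosine_laws) (simp_all add: k sine cosine)
  \<comment> \<open>The odd part \<open>f / k\<close> of \<open>chi\<close> cancels against its
    composition with \<open>\<sigma>\<close>.\<close>
  moreover have g_eq: "g = (\<lambda>x. (chi x + (chi \<circ> \<sigma>) x) / 2)"
    by (simp add: chi_def g_inv f_odd)
  \<comment> \<open>If \<open>chi\<close> vanished, so would \<open>g\<close>, then
    \<open>f\<close>, and finally \<open>c\<close>.\<close>
  moreover have "chi \<noteq> (\<lambda>x. 0)"
  proof
    assume "chi = (\<lambda>x. 0)"
    then have "g x = 0" for x using g_eq by (simp add: fun_eq_iff)
    then have "f = (\<lambda>x. 0)" using L_mult[of 0] by (simp add: f_def fun_eq_iff)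
    then show False using c L_mult[of 0] by (simp add: c_def)
  qed
  ultimately show ?thesis by blast
qed

end
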